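(* Let $p>2$ and let $\lambda$ be a JS-partition fixed under the Mullineux map, with residue symbol $R_p(\lambda)=\left\{\begin{smallmatrix}x_1&\cdots&x_m\\ y_1&\cdots&y_m\end{smallmatrix}\right\}$. Then - $\lambda_{(p)}=(l^l)$ if $(x_m,y_m)\in\{(l-1,1-l),(-l-1,l+1),(l,1+l),(-l,1-l)\}$ (entries mod $p$) with $1\le l\le\frac{p-1}{2}$; - $\lambda_{(p)}=\emptyset$ if $(x_m,y_m)\in\{(-1,1),(0,1)\}$.
   Context: Fix an integer $p\ge 2$. A partition is written $\lambda=(l_1^{a_1},\dots,l_t^{a_t})$ with $l_1>\dots>l_t>0$, $a_i\ge1$; $(l^l)$ is the square partition with $l$ parts equal to $l$. It is $p$-regular if all $a_i\le p-1$. A $p$-regular $\lambda$ is a JS-partition if $l_i-l_{i+1}+a_i+a_{i+1}\equiv 0\pmod p$ for $1\le i<t$. The $p$-core $\lambda_{(p)}$ is obtained by repeatedly removing rim hooks of length $p$ until none remains. Mullineux and residue symbols: the rim of $\lambda$ is the set of nodes $(i,j)$ of the Young diagram with $(i+1,j+1)$ not in it, ordered from the end of the first row to the start of the last row. The $p$-rim is the union of $p$-segments: the first consists of the first $p$ nodes of the rim (or all of it), each next one consists of the first $p$ (or all remaining) rim nodes starting at the last node of the row just below the lowest row of the previous segment, until the last row is reached. Let $a_1$ = size of the $p$-rim of $\lambda^{(1)}=\lambda$, $r_1$ = its number of parts; removing the $p$-rim gives $\lambda^{(2)}$; iterate until $\lambda^{(m+1)}=\emptyset$, defining $a_j,r_j$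 for $\lambda^{(j)}$. The Mullineux symbol is $G_p(\lambda)=\begin{pmatrix}a_1&\cdots&a_m\\ r_1&\cdots&r_m\end{pmatrix}$, which determines $\lambda$. The residue symbol $R_p(\lambda)$ has columns $(x_j,y_j)$ with $x_j\equiv a_{m+1-j}-r_{m+1-j}$, $y_j\equiv 1-r_{m+1-j}\pmod p$. Mullineux map: $\lambda^M$ is the $p$-regular partition with Mullineux symbol $\begin{pmatrix}a_1&\cdots&a_m\\ s_1&\cdots&s_m\end{pmatrix}$, $s_j=a_j-r_j+\varepsilon_j$, where $\varepsilon_j=0$ if $p\mid a_j$ and $\varepsilon_j=1$ otherwise; $\lambda$ is fixed if $\lambda^M=\lambda$. *)

theory Defs
  imports Main "HOL-Number_Theory.Cong"
begin

text \<open>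
  Partitions are weakly decreasing lists of positive parts. Nodes of Young diagrams are
  indexed from 0 in both coordinates; \<open>(i, j)\<close> lies in row \<open>i\<close> and column \<open>j\<close>.
\<close>

definition is_partition :: "nat list \<Rightarrow> bool" where
  "is_partition lam \<longleftrightarrow> sorted_wrt (\<ge>) lam \<and> (\<forall>x\<in>set lam. 0 < x)"

definition p_regular :: "nat \<Rightarrow> nat list \<Rightarrow> bool" where
  "p_regular p lam \<longleftrightarrow> is_partition lam \<and> (\<forall>x\<in>set lam. count_list lam x \<le> p - 1)"

text \<open>
  For a partition written as \<open>(l\<^sub>1^a\<^sub>1, \<dots>, l\<^sub>t^a\<^sub>t)\<close> with strictly decreasing \<open>l\<^sub>i\<close>, the list
  \<open>remdups_adj lam\<close> is \<open>[l\<^sub>1, \<dots>, l\<^sub>t]\<close> and \<open>count_list lam l\<^sub>i = a\<^sub>i\<close>.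
\<close>

definition JS_partition :: "nat \<Rightarrow> nat list \<Rightarrow> bool" where
  "JS_partition p lam \<longleftrightarrow> p_regular p lam \<and>
     (let ls = remdups_adj lam; a = (\<lambda>i. int (count_list lam (ls ! i))) in
      \<forall>i. Suc i < length ls \<longrightarrow>
        [int (ls ! i) - int (ls ! Suc i) + a i + a (Suc i) = 0] (mod int p))"

definition young :: "nat list \<Rightarrow> (nat \<times> nat) set" where
  "young lam = {(i, j). i < length lam \<and> j < lam ! i}"

text \<open>The rim, listed from the end of the first row to the start of the last row.\<close>

definition rim :: "nat list \<Rightarrow> (nat \<times> nat) list" where
  "rim lam = concat (map (\<lambda>i. filter (\<lambda>(i, j). (Suc i, Suc j) \<notin> young lam)
                              (map (Pair i) (rev [0..<lam ! i])))
                         [0..<length lam])"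

text \<open>
  \<open>remove_rim_hook p lam mu\<close>: \<open>mu\<close> arises from \<open>lam\<close> by removing a rim hook of length \<open>p\<close>,
  i.e. \<open>p\<close> consecutive nodes of the rim whose removal leaves a Young diagram.
\<close>

definition remove_rim_hook :: "nat \<Rightarrow> nat list \<Rightarrow> nat list \<Rightarrow> bool" where
  "remove_rim_hook p lam mu \<longleftrightarrow> is_partition lam \<and> is_partition mu \<and>
     (\<exists>k. k + p \<le> length (rim lam) \<and>
          young mu = young lam - set (take p (drop k (rim lam))))"

definition p_core :: "nat \<Rightarrow> nat list \<Rightarrow> nat list" where
  "p_core p lam = (THE kap. (remove_rim_hook p)\<^sup>*\<^sup>* lam kap \<and>
                            \<not> (\<exists>mu. remove_rim_hook p kap mu))"

text \<open>
  \<open>p_segments p ns\<close> runs through the tail \<open>ns\<close> of the rim: it takes a \<open>p\<close>-segment and continues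
  with the first node strictly below the lowest row of that segment, which is the last node of
  the next row.
\<close>

function p_segments :: "nat \<Rightarrow> (nat \<times> nat) list \<Rightarrow> (nat \<times> nat) list list" where
  "p_segments p [] = []"
| "p_segments p (n # ns) =
     (let seg = take p (n # ns) in
      seg # p_segments p (dropWhile (\<lambda>k. fst k \<le> fst (last seg)) ns))"
  by pat_completeness auto
termination
  by (relation "measure (length \<circ> snd)") (auto simp: less_Suc_eq_le length_dropWhile_le)

definition p_rim :: "nat \<Rightarrow> nat list \<Rightarrow> (nat \<times> nat) set" where
  "p_rim p lam = set (concat (p_segments p (rim lam)))"

definition remove_p_rim :: "nat \<Rightarrow> nat list \<Rightarrow> nat list" where
  "remove_p_rim p lam =
     filter (\<lambda>x. 0 < x) (map (\<lambda>i. card {j. (i, j) \<in> young lam - p_rim p lam}) [0..<length lam])"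

text \<open>
  The Mullineux symbol as its list of columns \<open>[(a\<^sub>1, r\<^sub>1), \<dots>, (a\<^sub>m, r\<^sub>m)]\<close>. Here
  \<open>(remove_p_rim p ^^ j) lam\<close> is \<open>lam\<close> after \<open>j\<close> removals, and \<open>m\<close> is the number of removals
  after which the empty partition is reached.
\<close>

definition mullineux_symbol :: "nat \<Rightarrow> nat list \<Rightarrow> (nat \<times> nat) list" where
  "mullineux_symbol p lam =
     map (\<lambda>j. let mu = (remove_p_rim p ^^ j) lam in (card (p_rim p mu), length mu))
         [0..<(LEAST m. (remove_p_rim p ^^ m) lam = [])]"

text \<open>Residues modulo \<open>p\<close> are represented by integers in \<open>{0..<p}\<close>.\<close>

definition residue_symbol :: "nat \<Rightarrow> nat list \<Rightarrow> (int \<times> int) list" where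
  "residue_symbol p lam =
     map (\<lambda>(a, r). ((int a - int r) mod int p, (1 - int r) mod int p))
         (rev (mullineux_symbol p lam))"

text \<open>
  The graph of the Mullineux map: \<open>mullineux_image p lam mu\<close> says that \<open>mu\<close> is the
  \<open>p\<close>-regular partition \<open>lam\<^sup>M\<close> with the transformed symbol. The new entries
  \<open>s\<^sub>j = a\<^sub>j - r\<^sub>j + \<epsilon>\<^sub>j\<close> are computed in the integers, so no truncation takes place.
\<close>

definition mullineux_image :: "nat \<Rightarrow> nat list \<Rightarrow> nat list \<Rightarrow> bool" where
  "mullineux_image p lam mu \<longleftrightarrow> p_regular p mu \<and>
     map (\<lambda>(a, s). (int a, int s)) (mullineux_symbol p mu) =
     map (\<lambda>(a, r). (int a, int a - int r + (if p dvd a then 0 else 1))) (mullineux_symbol p lam)"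

definition mullineux_fixed :: "nat \<Rightarrow> nat list \<Rightarrow> bool" where
  "mullineux_fixed p lam \<longleftrightarrow> mullineux_image p lam lam"

definition cong_pair :: "nat \<Rightarrow> int \<times> int \<Rightarrow> int \<times> int \<Rightarrow> bool" where
  "cong_pair p u v \<longleftrightarrow> [fst u = fst v] (mod int p) \<and> [snd u = snd v] (mod int p)"

end

theory Submission
  imports Defs
begin

text \<open>
  Write \<open>lam = (l\<^sub>1^a\<^sub>1, \<dots>, l\<^sub>t^a\<^sub>t)\<close> with \<open>r\<close> parts, and consider the beads \<open>lam\<^sub>i - i\<close> for
  \<open>i < r\<close>. The JS condition says exactly that the residues modulo \<open>p\<close> of the beads of consecutive
  blocks join up, so that all residues together run downwards from \<open>l\<^sub>t + a\<^sub>t - r\<close> through \<open>r\<close>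
  consecutive values. Removing rim hooks of length \<open>p\<close> preserves the number of beads in each
  residue class, so the core depends only on \<open>r\<close> and \<open>l\<^sub>t + a\<^sub>t\<close>; it is empty if \<open>p\<close> divides \<open>r\<close>.

  The JS condition also forces every \<open>p\<close>-segment to cover one block or two, whence the size of the
  \<open>p\<close>-rim is congruent to \<open>0\<close> or to \<open>l\<^sub>t + a\<^sub>t - 1\<close>. Being fixed by the Mullineux map makes this
  size \<open>2r - \<epsilon>\<close>. For \<open>r\<close> congruent to \<open>l\<close> or \<open>-l\<close> with \<open>0 < 2l < p\<close> this gives \<open>\<epsilon> = 1\<close> and
  \<open>l\<^sub>t + a\<^sub>t\<close> congruent to \<open>2r\<close>, and then the bead residues are those of the square \<open>(l^l)\<close>.
\<close>

section \<open>Contents of rim nodes\<close>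

text \<open>Zero rows past the last part allow a fixed number of beads for partitions of different
  lengths.\<close>

definition part :: "nat list \<Rightarrow> nat \<Rightarrow> nat" where
  "part lam i = (if i < length lam then lam ! i else 0)"

definition content :: "nat \<times> nat \<Rightarrow> int" where
  "content n = int (snd n) - int (fst n)"

lemma part_Nil [simp]: "part [] i = 0"
  by (simp add: part_def)

lemma part_Cons_0 [simp]: "part (x # xs) 0 = x"
  by (simp add: part_def)

lemma part_Cons_Suc [simp]: "part (x # xs) (Suc i) = part xs i"
  by (simp add: part_def)

lemma young_iff_part: "(i, j) \<in> young lam \<longleftrightarrow> j < part lam i"
  by (auto simp: young_def part_def)

lemma part_antimono:
  assumes "is_partition lam" "i \<le> j"
  shows "part lam j \<le> part lam i"
proof (cases "i = j")
  case False
  with assms show ?thesis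
    by (auto simp: part_def is_partition_def sorted_wrt_iff_nth_less)
qed auto

lemma part_pos_iff:
  assumes "is_partition lam"
  shows "0 < part lam i \<longleftrightarrow> i < length lam"
  using assms by (auto simp: part_def is_partition_def)

lemma is_partition_ConsD: "is_partition (x # xs) \<Longrightarrow> is_partition xs"
  by (simp add: is_partition_def)

lemma partition_eqI:
  assumes "is_partition lam" "is_partition mu" "\<And>i. part lam i = part mu i"
  shows "lam = mu"
proof -
  have "i < length lam \<longleftrightarrow> i < length mu" for i
    using assms part_pos_iff by metis
  hence "length lam = length mu"
    by (metis linorder_neqE_nat less_irrefl)
  moreover have "lam ! i = mu ! i" if "i < length lam" for i
    using assms(3)[of i] that calculation by (simp add: part_def)
  ultimately show ?thesis
    by (simp add: nth_equalityI)
qed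

text \<open>A rim row starts at the column just before the next part's length. Truncated subtraction
  yields column 0 for the last row, all of which lies on the rim. The row offset lets tails of a
  partition be treated by recursion.\<close>

fun rim_rows :: "nat \<Rightarrow> nat list \<Rightarrow> (nat \<times> nat) list" where
  "rim_rows i [] = []"
| "rim_rows i (x # xs) = map (Pair i) (rev [part xs 0 - 1..<x]) @ rim_rows (Suc i) xs"

lemma rim_rows_conv_concat:
  "concat (map (\<lambda>m. map (Pair (i + m)) (rev [part xs (Suc m) - 1..<xs ! m])) [0..<length xs])
     = rim_rows i xs"
proof (induction xs arbitrary: i)
  case (Cons x xs)
  have "[0..<length (x # xs)] = 0 # map Suc [0..<length xs]"
    by (metis length_Cons map_Suc_upt upt_conv_Cons zero_less_Suc)
  with Cons[of "Suc i"] show ?case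
    by (simp add: comp_def del: upt_Suc)
qed simp

lemma filter_upt_ge: "filter (\<lambda>j. a \<le> j) [0..<b] = [a..<b]"
  by (induction b) auto

lemma rim_eq_rim_rows: "rim lam = rim_rows 0 lam"
proof -
  have "filter (\<lambda>(i, j). (Suc i, Suc j) \<notin> young lam) (map (Pair i) (rev [0..<lam ! i]))
      = map (Pair i) (rev [part lam (Suc i) - 1..<lam ! i])" for i
  proof -
    have "((\<lambda>(i, j). (Suc i, Suc j) \<notin> young lam) \<circ> Pair i) = (\<lambda>j. part lam (Suc i) - 1 \<le> j)"
      by (auto simp: young_iff_part)
    then show ?thesis
      by (simp add: filter_map rev_filter[symmetric] filter_upt_ge)
  qed
  then show ?thesis
    unfolding rim_def rim_rows_conv_concat[symmetric] by simp
qed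

lemma map_int_upt: "map (\<lambda>j. int j - c) [a..<b] = [int a - c..int b - 1 - c]"
proof (induction b)
  case (Suc b)
  then show ?case
    by (auto simp: upto_rec2[of "int a - c" "int b - c"] algebra_simps)
qed simp

text \<open>Each step along the rim goes one node left or one node down, so the content drops by
  exactly 1. Contents therefore label rim nodes injectively by an interval.\<close>

lemma content_rim_rows:
  assumes "is_partition xs"
  shows "map content (rim_rows i xs)
    = rev [1 - int (length xs) - int i..int (part xs 0) - 1 - int i]"
  using assms
proof (induction xs arbitrary: i)
  case (Cons x xs)
  have xs: "is_partition xs"
    using Cons.prems by (rule is_partition_ConsD)
  have x: "part xs 0 \<le> x" "0 < x"
    using part_antimono[OF Cons.prems, of 0 1] Cons.prems by (auto simp: is_partition_def)
  have row: "map content (map (Pair i) (rev [part xs 0 - 1..<x]))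
      = rev [int (part xs 0 - 1) - int i..int x - 1 - int i]"
    by (simp add: content_def comp_def rev_map[symmetric] map_int_upt)
  show ?case
  proof (cases "xs = []")
    case True
    then show ?thesis using row by simp
  next
    case False
    hence h: "0 < part xs 0"
      using part_pos_iff[OF xs] by simp
    define m where "m = int (part xs 0) - 1 - int i"
    have "rev [m..int x - 1 - int i] @ rev [- int (length xs) - int i..m - 1]
        = rev [- int (length xs) - int i..int x - 1 - int i]"
      using x h False by (subst rev_append[symmetric], subst upto_split1[of _ m])
        (auto simp: m_def)
    moreover have "int (part xs 0 - 1) - int i = m"
      using h by (simp add: m_def)
    moreover have "map content (rim_rows (Suc i) xs) = rev [- int (length xs) - int i..m - 1]"
    proof -
      have "1 - int (length xs) - int (Suc i) = - int (length xs) - int i"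
        "int (part xs 0) - 1 - int (Suc i) = m - 1"
        by (simp_all add: m_def)
      with Cons.IH[OF xs, of "Suc i"] show ?thesis by metis
    qed
    ultimately show ?thesis
      using row by simp
  qed
qed simp

lemma content_rim:
  assumes "is_partition lam"
  shows "map content (rim lam) = rev [1 - int (length lam)..int (part lam 0) - 1]"
  using content_rim_rows[OF assms, of 0] by (simp add: rim_eq_rim_rows)

lemma content_rim_nth:
  assumes "is_partition lam" "m < length (rim lam)"
  shows "content (rim lam ! m) = int (part lam 0) - 1 - int m"
proof -
  let ?L = "[1 - int (length lam)..int (part lam 0) - 1]"
  have len: "m < length ?L"
    using arg_cong[OF content_rim[OF assms(1)], of length] assms(2) by simp
  have "content (rim lam ! m) = rev ?L ! m"
    using content_rim[OF assms(1)] assms(2) by (metis nth_map)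
  also have "\<dots> = ?L ! (length ?L - Suc m)"
    using len by (rule rev_nth)
  also have "\<dots> = 1 - int (length lam) + int (length ?L - Suc m)"
    using len by (intro nth_upto) (simp, linarith)
  also have "\<dots> = int (part lam 0) - 1 - int m"
    using len by simp
  finally show ?thesis .
qed

lemma distinct_content_rim: "is_partition lam \<Longrightarrow> distinct (map content (rim lam))"
  by (simp add: content_rim)

lemma inj_on_content_rim: "is_partition lam \<Longrightarrow> inj_on content (set (rim lam))"
  using distinct_content_rim by (simp add: distinct_map)

lemma content_set_rim:
  "is_partition lam \<Longrightarrow> content ` set (rim lam) = {1 - int (length lam)..int (part lam 0) - 1}"
  using arg_cong[OF content_rim, of lam set] by simp

lemma set_rim: "n \<in> set (rim lam) \<longleftrightarrow> n \<in> young lam \<and> (Suc (fst n), Suc (snd n)) \<notin> young lam"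
  by (cases n) (auto simp: rim_def young_def image_iff)

text \<open>Positions in the rim list and contents differ by a reflection, so a stretch of the list
  is a window of contents. This frees later arguments from list indices.\<close>

lemma set_hook:
  assumes lam: "is_partition lam" and k: "k + p \<le> length (rim lam)"
  defines "C \<equiv> int (part lam 0) - 1 - int k"
  shows "set (take p (drop k (rim lam))) = {n \<in> set (rim lam). C - int p < content n \<and> content n \<le> C}"
proof (intro equalityI subsetI)
  fix n assume "n \<in> set (take p (drop k (rim lam)))"
  then obtain m where "m < p" "n = rim lam ! (k + m)"
    using k by (auto simp: in_set_conv_nth)
  then show "n \<in> {n \<in> set (rim lam). C - int p < content n \<and> content n \<le> C}"
    using k by (auto simp: content_rim_nth[OF lam] C_def)
next
  fix n assume n: "n \<in> {n \<in> set (rim lam). C - int p < content n \<and> content n \<le> C}"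
  then obtain m where m: "m < length (rim lam)" "n = rim lam ! m"
    by (auto simp: in_set_conv_nth)
  with n have "k \<le> m" "m < k + p"
    by (auto simp: content_rim_nth[OF lam] C_def)
  then have "n = take p (drop k (rim lam)) ! (m - k)" "m - k < length (take p (drop k (rim lam)))"
    using m k by auto
  then show "n \<in> set (take p (drop k (rim lam)))"
    using nth_mem by blast
qed

lemma length_rim:
  assumes "is_partition lam"
  shows "length (rim lam) = nat (int (part lam 0) + int (length lam) - 1)"
  using arg_cong[OF content_rim[OF assms], of length] by simp

section \<open>Bead sets\<close>

text \<open>For nonzero rows these are the first-column hook lengths (beta-numbers) up to a common
  shift.\<close>

definition bead :: "nat list \<Rightarrow> nat \<Rightarrow> int" where
  "bead lam i = int (part lam i) - int i"

definition content_count :: "nat \<Rightarrow> nat list \<Rightarrow> int \<Rightarrow> nat" where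
  "content_count p lam c = card {n \<in> young lam. [content n = c] (mod int p)}"

text \<open>The number \<open>R\<close> of beads may exceed the number of parts. Keeping it fixed
  makes the counts comparable along a chain of hook removals.\<close>

definition bead_count :: "nat \<Rightarrow> nat \<Rightarrow> nat list \<Rightarrow> int \<Rightarrow> nat" where
  "bead_count p R lam c = (\<Sum>i<R. of_bool [bead lam i = c] (mod int p))"

lemma bead_strict_antimono:
  assumes "is_partition lam" "i < j"
  shows "bead lam j < bead lam i"
  using part_antimono[OF assms(1), of i j] assms(2) by (simp add: bead_def)

lemma inj_bead: "is_partition lam \<Longrightarrow> inj (bead lam)"
  by (metis bead_strict_antimono injI linorder_neqE_nat order_less_irrefl)

lemma young_eq_Sigma:
  assumes "length lam \<le> R"
  shows "young lam = Sigma {..<R} (\<lambda>i. {..<part lam i})"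
  using assms by (auto simp: young_def part_def split: if_splits)

lemma finite_young: "finite (young lam)"
  by (simp add: young_eq_Sigma[OF order_refl])

text \<open>Counting the nodes of a row by residue telescopes, since the contents of a row are
  consecutive.\<close>

lemma bead_count_content_count:
  assumes "length lam \<le> R"
  shows "int (bead_count p R lam c) - (\<Sum>i<R. of_bool [- int i = c] (mod int p))
    = int (content_count p lam (c - 1)) - int (content_count p lam c)"
proof -
  define f :: "int \<Rightarrow> int" where "f d = of_bool [d = c] (mod int p)" for d
  have count: "int (content_count p lam e)
      = (\<Sum>i<R. \<Sum>j<part lam i. of_bool [int j - int i = e] (mod int p))" for e
  proof -
    have "{n \<in> young lam. [content n = e] (mod int p)}
        = Sigma {..<R} (\<lambda>i. {j \<in> {..<part lam i}. [int j - int i = e] (mod int p)})"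
      by (auto simp: young_eq_Sigma[OF assms] content_def)
    then show ?thesis
      by (simp add: content_count_def Int_def)
  qed
  \<comment> \<open>Having residue \<open>c - 1\<close> at column \<open>j\<close> is having residue
    \<open>c\<close> at column \<open>j + 1\<close>, which is what makes the row sums
    telescope.\<close>
  have shift: "of_bool [int j - int i = c - 1] (mod int p) = f (int (Suc j) - int i)" for i j
    by (simp add: f_def cong_iff_dvd_diff algebra_simps)
  have "int (content_count p lam (c - 1)) - int (content_count p lam c)
      = (\<Sum>i<R. \<Sum>j<part lam i. f (int (Suc j) - int i) - f (int j - int i))"
    unfolding count shift by (simp add: f_def sum_subtractf)
  also have "\<dots> = (\<Sum>i<R. f (bead lam i) - f (- int i))"
    by (intro sum.cong refl, subst sum_lessThan_telescope) (simp add: bead_def)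
  also have "\<dots> = int (bead_count p R lam c) - (\<Sum>i<R. of_bool [- int i = c] (mod int p))"
    by (simp add: bead_count_def f_def sum_subtractf)
  finally show ?thesis by simp
qed

lemma card_cong_interval:
  fixes C c :: int
  assumes "p > 0"
  shows "card {d \<in> {C - int p<..C}. [d = c] (mod int p)} = 1"
proof -
  define d0 where "d0 = C - (C - c) mod int p"
  have "d = d0" if "C - int p < d" "d \<le> C" "[d = c] (mod int p)" for d
  proof -
    have "(C - d) mod int p = (C - c) mod int p"
      using that(3) by (metis cong_def mod_diff_right_eq)
    moreover have "(C - d) mod int p = C - d"
      using that by simp
    ultimately show ?thesis by (simp add: d0_def)
  qed
  moreover have "C - int p < d0" "d0 \<le> C"
    using assms by (simp_all add: d0_def)
  moreover have "[d0 = c] (mod int p)"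
    by (simp add: d0_def cong_def mod_diff_right_eq)
  ultimately have "{d \<in> {C - int p<..C}. [d = c] (mod int p)} = {d0}"
    unfolding set_eq_iff mem_Collect_eq greaterThanAtMost_iff singleton_iff by metis
  then show ?thesis by simp
qed

text \<open>The removed nodes have \<open>p\<close> consecutive contents, hence exactly one in each
  residue class.\<close>

lemma content_count_remove_rim_hook:
  assumes "p > 0" "remove_rim_hook p lam mu"
  shows "content_count p lam c = Suc (content_count p mu c)"
proof -
  obtain k where lam: "is_partition lam" and k: "k + p \<le> length (rim lam)"
    and mu: "young mu = young lam - set (take p (drop k (rim lam)))"
    using assms(2) by (auto simp: remove_rim_hook_def)
  define H where "H = set (take p (drop k (rim lam)))"
  define C where "C = int (part lam 0) - 1 - int k"
  have H: "H = {n \<in> set (rim lam). C - int p < content n \<and> content n \<le> C}"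
    unfolding H_def C_def by (rule set_hook[OF lam k])
  have "{C - int p<..C} \<subseteq> content ` set (rim lam)"
    using k \<open>p > 0\<close> by (auto simp: content_set_rim[OF lam] length_rim[OF lam] C_def)
  hence img: "content ` {n \<in> H. [content n = c] (mod int p)}
      = {d \<in> {C - int p<..C}. [d = c] (mod int p)}"
    unfolding H by (fastforce simp: image_iff subset_iff)
  have "inj_on content {n \<in> H. [content n = c] (mod int p)}"
    by (rule inj_on_subset[OF inj_on_content_rim[OF lam]]) (auto simp: H)
  from card_image[OF this] have one: "card {n \<in> H. [content n = c] (mod int p)} = 1"
    unfolding img card_cong_interval[OF assms(1)] by simp
  have "H \<subseteq> young lam"
    by (auto simp: H set_rim)
  hence "{n \<in> young lam. [content n = c] (mod int p)}
      = {n \<in> H. [content n = c] (mod int p)} \<union> {n \<in> young mu. [content n = c] (mod int p)}"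
    unfolding mu H_def[symmetric] by auto
  moreover have "{n \<in> H. [content n = c] (mod int p)} \<inter> {n \<in> young mu. [content n = c] (mod int p)} = {}"
    unfolding mu H_def[symmetric] by auto
  moreover have "finite H" by (simp add: H_def)
  ultimately show ?thesis
    using one by (simp add: content_count_def card_Un_disjoint finite_young)
qed

lemma length_le_if_young_subset:
  assumes "is_partition mu" "young mu \<subseteq> young lam"
  shows "length mu \<le> length lam"
proof (rule ccontr)
  assume "\<not> length mu \<le> length lam"
  hence "(length lam, 0) \<in> young mu"
    using part_pos_iff[OF assms(1)] by (simp add: young_iff_part)
  with assms(2) show False by (auto simp: young_def)
qed

text \<open>Bead counts depend only on differences of content counts of neighbouring residues. A
  removal lowers both counts by 1, so the difference survives.\<close>

lemma bead_count_remove_rim_hook: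
  assumes "p > 0" "remove_rim_hook p lam mu" "length lam \<le> R"
  shows "length mu \<le> R" and "bead_count p R mu c = bead_count p R lam c"
proof -
  show mu: "length mu \<le> R"
    using assms(2,3) length_le_if_young_subset[of mu lam] by (auto simp: remove_rim_hook_def)
  show "bead_count p R mu c = bead_count p R lam c"
    using bead_count_content_count[OF assms(3), of p c] bead_count_content_count[OF mu, of p c]
      content_count_remove_rim_hook[OF assms(1,2)] by simp
qed

lemma bead_count_rtranclp:
  assumes "(remove_rim_hook p)\<^sup>*\<^sup>* lam kap" "p > 0" "is_partition lam" "length lam \<le> R"
  shows "is_partition kap \<and> length kap \<le> R \<and> (\<forall>c. bead_count p R kap c = bead_count p R lam c)"
  using assms
proof (induction rule: rtranclp_induct)
  case (step mu nu)
  then show ?case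
    using bead_count_remove_rim_hook[of p mu nu R] by (auto simp: remove_rim_hook_def)
qed auto

section \<open>Cores\<close>

lemma finite_down_closed_nat:
  fixes A :: "nat set"
  assumes "finite A" "\<And>i j. j \<in> A \<Longrightarrow> i \<le> j \<Longrightarrow> i \<in> A"
  shows "A = {..<card A}"
proof -
  define m where "m = (LEAST m. m \<notin> A)"
  have "m \<notin> A"
    unfolding m_def using assms(1) by (metis LeastI ex_new_if_finite infinite_UNIV_nat)
  hence "A \<subseteq> {..<m}"
    using assms(2) by (meson lessThan_iff not_le subsetI)
  moreover have "{..<m} \<subseteq> A"
    unfolding m_def using not_less_Least by blast
  ultimately have "A = {..<m}" by blast
  then show ?thesis by simp
qed

text \<open>With this, a hook removal can be described as a set of nodes, without computing the
  parts of the result.\<close>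

lemma ex_partition_young:
  assumes fin: "finite D"
    and down: "\<And>i j i' j'. (i, j) \<in> D \<Longrightarrow> i' \<le> i \<Longrightarrow> j' \<le> j \<Longrightarrow> (i', j') \<in> D"
  shows "\<exists>mu. is_partition mu \<and> young mu = D"
proof -
  define r where "r i = card {j. (i, j) \<in> D}" for i
  define n where "n = card {i. (i, 0) \<in> D}"
  have finr: "finite {j. (i, j) \<in> D}" for i
    by (rule finite_subset[OF _ finite_imageI[OF fin, of snd]]) force
  have row: "{j. (i, j) \<in> D} = {..<r i}" for i
    unfolding r_def by (rule finite_down_closed_nat[OF finr]) (auto intro: down)
  have finn: "finite {i. (i, 0) \<in> D}"
    by (rule finite_subset[OF _ finite_imageI[OF fin, of fst]]) force
  have col: "{i. (i, 0) \<in> D} = {..<n}"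
    unfolding n_def by (rule finite_down_closed_nat[OF finn]) (auto intro: down)
  have D: "(i, j) \<in> D \<longleftrightarrow> j < r i" for i j
    using arg_cong[OF row[of i], of "\<lambda>A. j \<in> A"] by simp
  have pos: "0 < r i \<longleftrightarrow> i < n" for i
    using arg_cong[OF col, of "\<lambda>A. i \<in> A"] D[of i 0] by simp
  have anti: "r j \<le> r i" if "i \<le> j" for i j
  proof (rule ccontr)
    assume "\<not> r j \<le> r i"
    hence "(j, r i) \<in> D" by (simp add: D)
    hence "(i, r i) \<in> D" using down that by blast
    then show False by (simp add: D)
  qed
  have "is_partition (map r [0..<n])"
    using pos anti by (auto simp: is_partition_def sorted_wrt_iff_nth_less)
  moreover have "i < n" if "j < r i" for i j
    using pos[of i] that by simp
  hence "young (map r [0..<n]) = D"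
    by (auto simp: young_def D)
  ultimately show ?thesis by blast
qed

text \<open>Moving a bead from \<open>b\<close> to the free position \<open>b - p\<close> removes the rim nodes with
  contents \<open>b - p, \<dots>, b - 1\<close>.\<close>

lemma ex_remove_rim_hook:
  assumes lam: "is_partition lam" and "p > 0" and R: "length lam \<le> R"
    and b: "b \<in> bead lam ` {..<R}" and low: "1 - int R \<le> b - int p"
    and free: "b - int p \<notin> bead lam ` {..<R}"
  shows "\<exists>mu. remove_rim_hook p lam mu"
proof -
  obtain i0 where i0: "b = bead lam i0" "i0 < R" using b by auto
  \<comment> \<open>The zero rows occupy every position from \<open>- length lam\<close> down to
    \<open>1 - R\<close>, so a free position must lie above them.\<close>
  have free_low: "1 - int (length lam) \<le> b - int p"
  proof (rule ccontr)
    assume neg: "\<not> ?thesis"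
    define i where "i = nat (int p - b)"
    have "length lam \<le> i" "i < R" "int i = int p - b"
      using neg low by (auto simp: i_def)
    hence "b - int p = bead lam i" by (simp add: bead_def part_def)
    with \<open>i < R\<close> free show False by blast
  qed
  have i0_len: "i0 < length lam"
  proof (rule ccontr)
    assume "\<not> i0 < length lam"
    with i0 have "b = - int i0" by (simp add: bead_def part_def)
    with free_low \<open>p > 0\<close> \<open>\<not> i0 < length lam\<close> show False by simp
  qed
  have b_le: "b \<le> int (part lam 0)"
    using part_antimono[OF lam, of 0 i0] i0 by (simp add: bead_def)
  \<comment> \<open>This is the rim index of the node with content \<open>b - 1\<close>, which is
    the end of row \<open>i0\<close>.\<close>
  define k where "k = nat (int (part lam 0) - b)"
  define H where "H = set (take p (drop k (rim lam)))"
  have k: "k + p \<le> length (rim lam)"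
    using free_low b_le by (simp add: length_rim[OF lam] k_def)
  have H: "H = {n \<in> set (rim lam). b - 1 - int p < content n \<and> content n \<le> b - 1}"
    unfolding H_def set_hook[OF lam k] using b_le by (simp add: k_def)
  have end_rim: "(i0, part lam i0 - 1) \<in> set (rim lam)" "content (i0, part lam i0 - 1) = b - 1"
    using i0 i0_len part_pos_iff[OF lam, of i0] part_antimono[OF lam, of i0 "Suc i0"]
    by (auto simp: set_rim young_iff_part content_def bead_def)
  have down: "(i, j) \<in> young lam - H"
    if ij: "(i', j') \<in> young lam - H" "i \<le> i'" "j \<le> j'" for i j i' j'
  proof (rule ccontr)
    assume neg: "(i, j) \<notin> young lam - H"
    have young_down: "(u, v) \<in> young lam" if "(u', v') \<in> young lam" "u \<le> u'" "v \<le> v'" for u v u' v'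
      using that part_antimono[OF lam, of u u'] by (simp add: young_iff_part)
    have "(i, j) \<in> young lam"
      using ij young_down by blast
    with neg have inH: "(i, j) \<in> H" by blast
    hence nrim: "(Suc i, Suc j) \<notin> young lam" by (simp add: H set_rim)
    hence "(Suc i, Suc j) \<noteq> (i', j')" "i' = i \<or> j' = j"
      using ij young_down[of i' j' "Suc i" "Suc j"] by force+
    moreover have "(i', j') \<in> set (rim lam)"
      using ij nrim young_down[of "Suc i'" "Suc j'" "Suc i" "Suc j"] by (auto simp: set_rim)
    \<comment> \<open>If \<open>(i, j)\<close> is removed and \<open>(i', j')\<close> to its
      south-east stays, both are rim nodes. The second then lies beyond the hook, either to the
      right in the same row or below in the same column.\<close>
    ultimately consider "i' = i" "content (i', j') > b - 1" | "j' = j" "content (i', j') \<le> b - 1 - int p"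
      using ij inH unfolding H by (force simp: content_def)
    then show False
    proof cases
      case 1
      \<comment> \<open>The node of row \<open>i\<close> with content \<open>b - 1\<close> must be
        the end of row \<open>i0\<close>, yet \<open>(i, j')\<close> lies further right in that
        row.\<close>
      define v where "v = nat (b - 1 + int i)"
      have v: "int v = b - 1 + int i" "j \<le> v" "v < j'"
        using 1 inH by (auto simp: H content_def v_def)
      have "(i, v) \<in> set (rim lam)"
        using v 1 ij nrim young_down[of i j' i v] young_down[of "Suc i" "Suc v" "Suc i" "Suc j"]
        by (auto simp: set_rim)
      moreover have "content (i, v) = b - 1"
        using v by (simp add: content_def)
      ultimately have "(i, v) = (i0, part lam i0 - 1)"
        using end_rim inj_on_content_rim[OF lam] by (metis inj_onD)
      with v 1 ij show False by (auto simp: young_iff_part)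
    next
      case 2
      \<comment> \<open>The node of column \<open>j\<close> with content \<open>b - p\<close> lies
        in row \<open>u\<close>. Row \<open>u + 1\<close> then has length exactly
        \<open>j + 1\<close>, which puts a bead on the position \<open>b - p\<close> assumed
        free.\<close>
      define u where "u = nat (int j - (b - int p))"
      have u: "int u = int j - (b - int p)" "i \<le> u" "u < i'"
        using 2 inH by (auto simp: H content_def u_def)
      have "(Suc u, Suc j) \<notin> young lam"
        using nrim u young_down[of "Suc u" "Suc j" "Suc i" "Suc j"] by auto
      moreover have "(Suc u, j) \<in> young lam"
        using ij u 2 young_down[of i' j "Suc u" j] by auto
      ultimately have "part lam (Suc u) = Suc j"
        by (simp add: young_iff_part)
      hence "bead lam (Suc u) = b - int p" "Suc u < length lam"
        using u part_pos_iff[OF lam, of "Suc u"] by (auto simp: bead_def)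
      with free R show False
        by (metis imageI lessThan_iff order_less_le_trans)
    qed
  qed
  obtain mu where "is_partition mu" "young mu = young lam - H"
    using ex_partition_young[of "young lam - H"] down finite_young by blast
  then show ?thesis
    using lam k by (auto simp: remove_rim_hook_def H_def)
qed

text \<open>Every removal takes at least one node, so the process stops. This is the existence half
  for the definite description in \<open>p_core\<close>.\<close>

lemma ex_terminal_hook_removal:
  assumes "is_partition lam" "p > 0"
  shows "\<exists>kap. (remove_rim_hook p)\<^sup>*\<^sup>* lam kap \<and> \<not> (\<exists>mu. remove_rim_hook p kap mu)"
  using assms(1)
proof (induction "card (young lam)" arbitrary: lam rule: less_induct)
  case less
  show ?case
  proof (cases "\<exists>mu. remove_rim_hook p lam mu")
    case True
    then obtain mu k where mu: "remove_rim_hook p lam mu" "is_partition mu"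
      and k: "k + p \<le> length (rim lam)" "young mu = young lam - set (take p (drop k (rim lam)))"
      by (auto simp: remove_rim_hook_def)
    have "rim lam ! k \<in> set (take p (drop k (rim lam)))"
      using k \<open>p > 0\<close> by (auto simp: in_set_conv_nth intro!: exI[of _ 0])
    moreover have "rim lam ! k \<in> young lam"
      using k \<open>p > 0\<close> nth_mem[of k "rim lam"] by (simp add: set_rim)
    ultimately have "young mu \<subset> young lam"
      using k by blast
    hence "card (young mu) < card (young lam)"
      by (simp add: finite_young psubset_card_mono)
    from less.hyps[OF this mu(2)] mu(1) show ?thesis
      by (meson converse_rtranclp_into_rtranclp)
  qed blast
qed

section \<open>Runners of the abacus and uniqueness of the core\<close>

lemma down_closed_runner:
  fixes X :: "int set"
  assumes closed: "\<And>b. b \<in> X \<Longrightarrow> N \<le> b - int p \<Longrightarrow> b - int p \<in> X"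
    and "b \<in> X" "N \<le> d" "d \<le> b" "[d = b] (mod int p)"
  shows "d \<in> X"
proof (cases "p = 0")
  case False
  have iter: "N \<le> b - int k * int p \<Longrightarrow> b - int k * int p \<in> X" for k
  proof (induction k)
    case (Suc k)
    have "b - int k * int p - int p \<in> X"
      using Suc closed[of "b - int k * int p"] by (simp add: algebra_simps)
    then show ?case by (simp add: algebra_simps)
  qed (use assms in simp)
  obtain m where m: "b - d = int p * m"
    using assms(5) by (metis cong_iff_dvd_diff cong_sym dvdE)
  hence "0 \<le> m"
    using assms(4) False by (metis diff_ge_0_iff_ge mult_less_0_iff not_le of_nat_0_less_iff neq0_conv)
  hence "d = b - int (nat m) * int p"
    using m by (simp add: algebra_simps)
  with iter[of "nat m"] assms(3) show ?thesis by simp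
qed (use assms in \<open>simp add: cong_def\<close>)

text \<open>Within each residue class both sets are initial segments above the common bound
  \<open>N\<close>, hence comparable by inclusion. Equal cardinalities then force equality.\<close>

lemma closed_sets_eqI:
  fixes X Y :: "int set"
  assumes "finite X" "finite Y" "\<And>b. b \<in> X \<Longrightarrow> N \<le> b" "\<And>b. b \<in> Y \<Longrightarrow> N \<le> b"
    and cX: "\<And>b. b \<in> X \<Longrightarrow> N \<le> b - int p \<Longrightarrow> b - int p \<in> X"
    and cY: "\<And>b. b \<in> Y \<Longrightarrow> N \<le> b - int p \<Longrightarrow> b - int p \<in> Y"
    and count: "\<And>c. card {b \<in> X. [b = c] (mod int p)} = card {b \<in> Y. [b = c] (mod int p)}"
  shows "X = Y"
proof -
  have same: "{b \<in> X. [b = c] (mod int p)} = {b \<in> Y. [b = c] (mod int p)}" (is "?X = ?Y") for c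
  proof -
    have "?X \<subseteq> ?Y \<or> ?Y \<subseteq> ?X"
    proof (rule ccontr)
      assume "\<not> ?thesis"
      then obtain x y where "x \<in> ?X" "x \<notin> ?Y" "y \<in> ?Y" "y \<notin> ?X"
        by blast
      hence xy: "x \<in> X" "x \<notin> Y" "y \<in> Y" "y \<notin> X"
        and c: "[x = y] (mod int p)" "[y = x] (mod int p)"
        by (auto simp: cong_def)
      show False
        using down_closed_runner[of X N p x y, OF cX] down_closed_runner[of Y N p y x, OF cY]
          xy c assms(3,4) by (meson linear)
    qed
    then show ?thesis
    proof
      assume "?X \<subseteq> ?Y"
      then show ?thesis
        by (rule card_subset_eq[rotated]) (simp_all add: count assms(2))
    next
      assume "?Y \<subseteq> ?X"
      then show ?thesis
        by (rule card_subset_eq[rotated, symmetric]) (simp_all add: count assms(1))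
    qed
  qed
  have "x \<in> X \<longleftrightarrow> x \<in> Y" for x
    using arg_cong[OF same[of x], of "\<lambda>A. x \<in> A"] by simp
  then show ?thesis by blast
qed

lemma bead_count_eq_card:
  assumes "is_partition lam"
  shows "bead_count p R lam c = card {b \<in> bead lam ` {..<R}. [b = c] (mod int p)}"
proof -
  have "{b \<in> bead lam ` {..<R}. [b = c] (mod int p)}
      = bead lam ` {i \<in> {..<R}. [bead lam i = c] (mod int p)}"
    by auto
  then show ?thesis
    using inj_on_subset[OF inj_bead[OF assms]] by (simp add: card_image bead_count_def Int_def)
qed

text \<open>Beads strictly decrease with the row, so a bead's row is the number of larger beads and
  the set determines the sequence.\<close>

lemma partition_eqI_beads:
  assumes "is_partition lam" "is_partition mu" "length lam \<le> R" "length mu \<le> R"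
    and eq: "bead lam ` {..<R} = bead mu ` {..<R}"
  shows "lam = mu"
proof -
  have pos: "card {x \<in> bead nu ` {..<R}. bead nu i < x} = i" if "is_partition nu" "i < R" for nu i
  proof -
    have "bead nu i < bead nu j \<longleftrightarrow> j < i" for j
      using bead_strict_antimono[OF that(1)]
      by (metis linorder_neqE_nat order_less_asym order_less_irrefl)
    hence "{x \<in> bead nu ` {..<R}. bead nu i < x} = bead nu ` {..<i}"
      using that(2) by auto
    then show ?thesis
      using inj_on_subset[OF inj_bead[OF that(1)]] by (simp add: card_image)
  qed
  have "part lam i = part mu i" for i
  proof (cases "i < R")
    case True
    then obtain j where j: "j < R" "bead lam i = bead mu j"
      using eq by blast
    have "i = j"
      using pos[OF assms(1) True] pos[OF assms(2) j(1)] j(2) eq by simp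
    with j show ?thesis by (simp add: bead_def)
  qed (use assms in \<open>simp add: part_def\<close>)
  then show ?thesis
    using partition_eqI assms by blast
qed

text \<open>A partition without removable hooks has a bead set closed under admissible shifts by
  \<open>- p\<close>, and its counts are those of \<open>lam\<close>. So it coincides with any
  closed candidate \<open>kap\<close> having these counts; that \<open>kap\<close> is reachable then
  follows from the existence of a terminal partition.\<close>

lemma p_core_eqI:
  assumes "p > 0" "is_partition lam" "is_partition kap" "length lam \<le> R" "length kap \<le> R"
    and closed: "\<And>b. b \<in> bead kap ` {..<R} \<Longrightarrow> 1 - int R \<le> b - int p
      \<Longrightarrow> b - int p \<in> bead kap ` {..<R}"
    and count: "\<And>c. bead_count p R lam c = bead_count p R kap c"
  shows "p_core p lam = kap"
proof -
  have unique: "mu = kap"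
    if "(remove_rim_hook p)\<^sup>*\<^sup>* lam mu" "\<not> (\<exists>nu. remove_rim_hook p mu nu)" for mu
  proof -
    have mu: "is_partition mu" "length mu \<le> R" "\<And>c. bead_count p R mu c = bead_count p R lam c"
      using bead_count_rtranclp[OF that(1)] assms by auto
    have "bead mu ` {..<R} = bead kap ` {..<R}"
    proof (rule closed_sets_eqI[where N = "1 - int R" and p = p])
      show "b - int p \<in> bead mu ` {..<R}" if "b \<in> bead mu ` {..<R}" "1 - int R \<le> b - int p" for b
        using ex_remove_rim_hook[OF mu(1) assms(1) mu(2)] that \<open>\<not> (\<exists>nu. remove_rim_hook p mu nu)\<close>
        by blast
      show "card {b \<in> bead mu ` {..<R}. [b = c] (mod int p)}
          = card {b \<in> bead kap ` {..<R}. [b = c] (mod int p)}" for c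
        using mu count assms by (simp flip: bead_count_eq_card)
    qed (use closed in \<open>auto simp: bead_def\<close>)
    then show ?thesis
      using partition_eqI_beads mu assms by blast
  qed
  obtain mu where "(remove_rim_hook p)\<^sup>*\<^sup>* lam mu" "\<not> (\<exists>nu. remove_rim_hook p mu nu)"
    using ex_terminal_hook_removal assms by blast
  then show ?thesis
    unfolding p_core_def using unique by (intro the_equality) blast+
qed

section \<open>Blocks of equal parts\<close>

fun expand :: "(nat \<times> nat) list \<Rightarrow> nat list" where
  "expand [] = []"
| "expand ((l, a) # bs) = replicate a l @ expand bs"

text \<open>Recursive form of the JS condition, suited to splitting off leading blocks.\<close>

fun JS_blocks :: "nat \<Rightarrow> (nat \<times> nat) list \<Rightarrow> bool" where
  "JS_blocks p [] \<longleftrightarrow> True"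
| "JS_blocks p [(l, a)] \<longleftrightarrow> 0 < l \<and> 0 < a \<and> a < p"
| "JS_blocks p ((l, a) # (k, b) # bs) \<longleftrightarrow> k < l \<and> 0 < a \<and> a < p
     \<and> [int l - int k + int a + int b = 0] (mod int p) \<and> JS_blocks p ((k, b) # bs)"

lemma sorted_remdups_adj:
  fixes xs :: "nat list"
  shows "sorted_wrt (\<ge>) xs \<Longrightarrow> sorted_wrt (>) (remdups_adj xs)"
  by (induction xs rule: remdups_adj.induct) fastforce+

text \<open>Sortedness makes equal parts adjacent, so grouping by value loses nothing.\<close>

lemma expand_remdups_adj:
  "sorted_wrt (\<ge>) xs \<Longrightarrow> expand (map (\<lambda>l. (l, count_list xs l)) (remdups_adj xs)) = xs"
proof (induction xs rule: remdups_adj.induct)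
  case (3 x y xs)
  show ?case
  proof (cases "x = y")
    case True
    obtain zs where zs: "remdups_adj (y # xs) = y # zs"
      by (metis remdups_adj_Cons_alt)
    have "sorted_wrt (>) (y # zs)"
      using sorted_remdups_adj[of "y # xs"] 3 zs by simp
    hence "y \<notin> set zs" by auto
    define F where "F = (\<lambda>l. (l, count_list (y # y # xs) l))"
    define G where "G = (\<lambda>l. (l, count_list (y # xs) l))"
    have "F y = (y, Suc (count_list (y # xs) y))" "G y = (y, count_list (y # xs) y)"
      "map F zs = map G zs"
      using \<open>y \<notin> set zs\<close> by (auto simp: F_def G_def)
    moreover have "expand (map G (y # zs)) = y # xs"
      using "3.IH"(1)[OF True] "3.prems" True zs unfolding G_def by simp
    ultimately have "expand (map F (y # zs)) = y # y # xs"
      by (simp del: map_eq_conv)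
    with True zs show ?thesis
      unfolding F_def by simp
  next
    case False
    with 3 have "x \<notin> set (y # xs)" by auto
    define F where "F = (\<lambda>l. (l, count_list (x # y # xs) l))"
    define G where "G = (\<lambda>l. (l, count_list (y # xs) l))"
    have "F x = (x, 1)" "map F (remdups_adj (y # xs)) = map G (remdups_adj (y # xs))"
      using \<open>x \<notin> set (y # xs)\<close> by (auto simp: F_def G_def count_list_0_iff)
    moreover have "expand (map G (remdups_adj (y # xs))) = y # xs"
      using "3.IH"(2)[OF False] "3.prems" unfolding G_def by simp
    ultimately have "expand (map F (x # remdups_adj (y # xs))) = x # y # xs"
      by (simp del: map_eq_conv)
    with False show ?thesis
      unfolding F_def by simp
  qed
qed auto

lemma JS_blocks_map:
  assumes "sorted_wrt (>) ls" "\<And>l. l \<in> set ls \<Longrightarrow> 0 < l \<and> 0 < f l \<and> f l < p"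
    and "\<And>i. Suc i < length ls \<Longrightarrow>
      [int (ls ! i) - int (ls ! Suc i) + int (f (ls ! i)) + int (f (ls ! Suc i)) = 0] (mod int p)"
  shows "JS_blocks p (map (\<lambda>l. (l, f l)) ls)"
  using assms
proof (induction ls rule: induct_list012)
  case (3 x y zs)
  have "JS_blocks p (map (\<lambda>l. (l, f l)) (y # zs))"
  proof (rule "3.IH"(2))
    show "[int ((y # zs) ! i) - int ((y # zs) ! Suc i) + int (f ((y # zs) ! i))
        + int (f ((y # zs) ! Suc i)) = 0] (mod int p)" if "Suc i < length (y # zs)" for i
      using "3.prems"(3)[of "Suc i"] that by simp
  qed (use "3.prems" in auto)
  then show ?case
    using "3.prems"(1,2) "3.prems"(3)[of 0] by simp
qed auto

lemma ex_JS_blocks: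
  assumes "JS_partition p lam"
  shows "\<exists>bs. JS_blocks p bs \<and> expand bs = lam"
proof -
  have sorted: "sorted_wrt (\<ge>) lam" and pos: "\<And>x. x \<in> set lam \<Longrightarrow> 0 < x"
    and mult: "\<And>x. x \<in> set lam \<Longrightarrow> count_list lam x \<le> p - 1"
    using assms by (auto simp: JS_partition_def p_regular_def is_partition_def)
  have "0 < count_list lam x \<and> count_list lam x < p" if "x \<in> set lam" for x
  proof -
    have "count_list lam x \<noteq> 0" using that by (simp add: count_list_0_iff)
    with mult[OF that] show ?thesis by linarith
  qed
  hence "JS_blocks p (map (\<lambda>l. (l, count_list lam l)) (remdups_adj lam))"
    using assms pos by (intro JS_blocks_map sorted_remdups_adj sorted)
      (auto simp: JS_partition_def Let_def)
  with expand_remdups_adj[OF sorted] show ?thesis by blast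
qed

lemma JS_blocks_tl: "JS_blocks p (x # bs) \<Longrightarrow> JS_blocks p bs"
  by (cases x; cases bs) auto

lemma JS_blocks_pos: "JS_blocks p ((l, a) # bs) \<Longrightarrow> 0 < l \<and> 0 < a \<and> a < p"
  by (induction p "(l, a) # bs" arbitrary: l a bs rule: JS_blocks.induct) auto

lemma part_replicate_append:
  "part (replicate a l @ xs) i = (if i < a then l else part xs (i - a))"
  by (auto simp: part_def nth_append)

lemma part_expand_less:
  assumes "JS_blocks p ((l, a) # bs)"
  shows "part (expand bs) 0 < l"
proof (cases bs)
  case (Cons x ds)
  obtain k b where x: "x = (k, b)" by fastforce
  have "0 < b" "k < l"
    using assms JS_blocks_tl[OF assms] JS_blocks_pos[of p k b ds] Cons x by auto
  then show ?thesis
    by (simp add: Cons x part_replicate_append)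
qed (use assms in simp)

text \<open>The beads of consecutive blocks occupy adjacent intervals of residues, so those of the whole
  partition run through consecutive residues.\<close>

lemma JS_blocks_first_last:
  assumes "JS_blocks p ((l, a) # bs)" "last ((l, a) # bs) = (k, b)"
  shows "[int l + int a = int k + int b - 2 * int (length (expand bs))] (mod int p)"
  using assms
proof (induction bs arbitrary: l a)
  case (Cons x bs)
  obtain l' a' where x: "x = (l', a')" by fastforce
  have "[int l' + int a' = int k + int b - 2 * int (length (expand bs))] (mod int p)"
    using Cons x by (auto split: if_splits)
  moreover have "[int l - int l' + int a + int a' = 0] (mod int p)"
    using Cons.prems x by simp
  ultimately have "[int l' + int a' + (int l - int l' + int a + int a')
      = int k + int b - 2 * int (length (expand bs)) + 0] (mod int p)"
    by (rule cong_add)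
  hence "[int l' + int a' + (int l - int l' + int a + int a') - 2 * int a'
      = int k + int b - 2 * int (length (expand bs)) + 0 - 2 * int a'] (mod int p)"
    by (rule cong_diff) simp
  then show ?case
    by (simp add: x algebra_simps)
qed auto

lemma sum_lessThan_add:
  fixes f :: "nat \<Rightarrow> 'a::comm_monoid_add"
  shows "(\<Sum>i<m + n. f i) = (\<Sum>i<m. f i) + (\<Sum>i<n. f (m + i))"
  by (induction n) (simp_all add: add.assoc)

text \<open>The shift \<open>s\<close> counts the rows already split off above \<open>bs\<close>; it
  is generalised for the induction.\<close>

lemma bead_count_blocks_shift:
  assumes "JS_blocks p bs" "bs \<noteq> []" "last bs = (k, b)"
  defines "N \<equiv> length (expand bs)"
  shows "(\<Sum>i<N. of_bool [bead (expand bs) i - int s = c] (mod int p))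
    = (\<Sum>i<N. of_bool [int k + int b - int N - int s - int i = c] (mod int p) :: nat)"
  unfolding N_def using assms(1-3)
proof (induction bs arbitrary: s)
  case (Cons x bs)
  obtain l a where x: "x = (l, a)" by fastforce
  define n where "n = length (expand bs)"
  define e where "e = int k + int b - int (n + a) - int s"
  have first: "[int l + int a = int k + int b - 2 * int n] (mod int p)"
    using JS_blocks_first_last[of p l a bs k b] Cons.prems x by (simp add: n_def)
  \<comment> \<open>Modulo \<open>p\<close>, the later blocks fill the top \<open>n\<close> values
    of the run starting at \<open>e\<close>, and the first block fills the \<open>a\<close> values
    just below them.\<close>
  have block: "[int l - int i - int s = c] (mod int p) \<longleftrightarrow> [e - int (n + i) = c] (mod int p)" for i
  proof -
    have "[int l + int a - (int a + int i + int s)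
        = int k + int b - 2 * int n - (int a + int i + int s)] (mod int p)"
      using first by (rule cong_diff) simp
    hence "[int l - int i - int s = e - int (n + i)] (mod int p)"
      by (simp add: e_def algebra_simps)
    then show ?thesis
      by (meson cong_sym cong_trans)
  qed
  have rest: "(\<Sum>i<n. of_bool [bead (expand bs) i - int (a + s) = c] (mod int p))
      = (\<Sum>i<n. of_bool [e - int i = c] (mod int p) :: nat)"
  proof (cases "bs = []")
    case False
    have "int k + int b - int n - int (a + s) = e"
      by (simp add: e_def)
    with Cons.IH[of "a + s"] Cons.prems False show ?thesis
      unfolding n_def[symmetric] by (metis JS_blocks_tl last_ConsR)
  qed (simp add: n_def)
  have "(\<Sum>i<a + n. of_bool [bead (expand (x # bs)) i - int s = c] (mod int p) :: nat)
      = (\<Sum>i<a. of_bool [int l - int i - int s = c] (mod int p))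
        + (\<Sum>i<n. of_bool [bead (expand bs) i - int (a + s) = c] (mod int p))"
    unfolding sum_lessThan_add
    by (intro arg_cong2[where f = "(+)"] sum.cong refl)
      (simp_all add: x bead_def part_replicate_append algebra_simps)
  also have "\<dots> = (\<Sum>i<a. of_bool [e - int (n + i) = c] (mod int p))
        + (\<Sum>i<n. of_bool [e - int i = c] (mod int p))"
    unfolding rest block ..
  also have "\<dots> = (\<Sum>i<n + a. of_bool [e - int i = c] (mod int p))"
    unfolding sum_lessThan_add by simp
  finally show ?case
    by (simp add: x e_def n_def add.commute)
qed simp

lemma bead_count_blocks:
  assumes "JS_blocks p bs" "bs \<noteq> []" "last bs = (k, b)" "N = length (expand bs)"
  shows "bead_count p N (expand bs) c
    = (\<Sum>i<N. of_bool [int k + int b - int N - int i = c] (mod int p))"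
  using bead_count_blocks_shift[OF assms(1-3), of 0 c] by (simp add: bead_count_def assms(4))

section \<open>The size of the p-rim\<close>

text \<open>Rim of a block of \<open>a\<close> rows of length \<open>l\<close> above a row of length
  \<open>h\<close>: all rows but the last contribute only their end node.\<close>

definition block_rim :: "nat \<Rightarrow> nat \<Rightarrow> nat \<Rightarrow> nat \<Rightarrow> (nat \<times> nat) list" where
  "block_rim i a l h = map (\<lambda>m. (i + m, l - 1)) [0..<a - 1] @ map (Pair (i + (a - 1))) (rev [h - 1..<l])"

lemma rim_rows_block:
  assumes "a > 0" "l > 0"
  shows "rim_rows i (replicate a l @ xs) = block_rim i a l (part xs 0) @ rim_rows (i + a) xs"
proof -
  have "rim_rows i (replicate (Suc n) l @ xs)
      = block_rim i (Suc n) l (part xs 0) @ rim_rows (i + Suc n) xs" for n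
  proof (induction n arbitrary: i)
    case (Suc n)
    have "[l - 1..<l] = [l - 1]"
      using assms(2) by (cases l) auto
    moreover have "[0..<Suc n] = 0 # map Suc [0..<n]"
      by (metis map_Suc_upt upt_conv_Cons zero_less_Suc)
    ultimately show ?case
      using Suc[of "Suc i"] by (simp add: block_rim_def part_replicate_append comp_def del: upt_Suc)
  qed (simp add: block_rim_def)
  from this[of "a - 1"] assms(1) show ?thesis by simp
qed

lemma length_block_rim: "length (block_rim i a l h) = a - 1 + (l - (h - 1))"
  by (simp add: block_rim_def)

lemma distinct_block_rim: "distinct (block_rim i a l h)"
  by (auto simp: block_rim_def distinct_map inj_on_def)

lemma row_block_rim:
  assumes "a > 0" "n \<in> set (block_rim i a l h)"
  shows "i \<le> fst n" and "fst n < i + a"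
  using assms by (auto simp: block_rim_def)

lemma row_block_rim_nth:
  assumes "a - 1 \<le> m" "m < length (block_rim i a l h)"
  shows "fst (block_rim i a l h ! m) = i + (a - 1)"
  using assms by (auto simp: block_rim_def nth_append)

lemma row_rim_rows: "n \<in> set (rim_rows i xs) \<Longrightarrow> i \<le> fst n"
  by (induction i xs rule: rim_rows.induct) (auto dest: Suc_leD)

lemma set_p_segments_subset: "set (concat (p_segments p ns)) \<subseteq> set ns"
proof (induction p ns rule: p_segments.induct)
  case (2 p n ns)
  then show ?case
    by (auto simp: Let_def dest: in_set_takeD set_dropWhileD)
qed simp

text \<open>Here \<open>u\<close> is the first segment, \<open>v\<close> the nodes skipped after it
  and \<open>w\<close> the part of the rim where the next segment starts. Segments in
  \<open>w\<close> lie in lower rows, so sizes add.\<close>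

lemma card_p_segments:
  assumes seg: "take p (u @ v @ w) = u" and u: "u \<noteq> []" "distinct u"
    and le: "\<And>n. n \<in> set (u @ v) \<Longrightarrow> fst n \<le> fst (last u)"
    and gt: "\<And>n. n \<in> set w \<Longrightarrow> fst (last u) < fst n"
  shows "card (set (concat (p_segments p (u @ v @ w))))
    = length u + card (set (concat (p_segments p w)))"
proof -
  obtain n ns where n: "u = n # ns" using u by (cases u) auto
  have "dropWhile (\<lambda>k. fst k \<le> fst (last u)) ((ns @ v) @ w)
      = dropWhile (\<lambda>k. fst k \<le> fst (last u)) w"
    using le n by (intro dropWhile_append2) auto
  also have "\<dots> = w"
    using gt by (cases w) (auto simp: not_le)
  finally have "p_segments p (u @ v @ w) = u # p_segments p w"
    using seg n by (simp add: Let_def)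
  moreover have "set u \<inter> set (concat (p_segments p w)) = {}"
    using set_p_segments_subset[of p w] le gt by fastforce
  ultimately show ?thesis
    using u by (simp add: card_Un_disjoint distinct_card)
qed

text \<open>A \<open>p\<close>-segment starting at the top of a block ends in the last row of that block or, by the
  congruence between neighbouring blocks, at the first rim node in the last row of the next block.\<close>

lemma card_p_segments_blocks:
  assumes "JS_blocks p bs" "bs \<noteq> []" "last bs = (k, b)"
  shows "[card (set (concat (p_segments p (rim_rows i (expand bs))))) = 0] (mod p)
    \<or> [card (set (concat (p_segments p (rim_rows i (expand bs))))) = k + b - 1] (mod p)"
  using assms
proof (induction bs arbitrary: i rule: length_induct)
  case (1 bs)
  define S where "S j cs = card (set (concat (p_segments p (rim_rows j (expand cs)))))" for j cs
  have IH: "[S j cs = 0] (mod p) \<or> [S j cs = k + b - 1] (mod p)"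
    if "length cs < length bs" "JS_blocks p cs" "cs \<noteq> [] \<Longrightarrow> last cs = (k, b)" for j cs
    using 1(1) that by (cases "cs = []") (auto simp: S_def)
  obtain l a cs where bs: "bs = (l, a) # cs"
    using 1 by (metis neq_Nil_conv surj_pair)
  have la: "0 < l" "0 < a" "a < p"
    using 1(2) bs JS_blocks_pos by auto
  define h where "h = part (expand cs) 0"
  define B where "B = block_rim i a l h"
  have h: "h < l"
    using part_expand_less 1(2) bs by (simp add: h_def)
  have rim: "rim_rows i (expand bs) = B @ rim_rows (i + a) (expand cs)"
    by (simp add: bs B_def h_def rim_rows_block la)
  have lenB: "length B = a - 1 + (l - (h - 1))"
    by (simp add: B_def length_block_rim)
  have rowsB: "fst n \<le> i + (a - 1)" if "n \<in> set B" for n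
    using row_block_rim[OF la(2), of n i l h] that by (simp add: B_def)
  have last_row: "fst (B ! m) = i + (a - 1)" if "a - 1 \<le> m" "m < length B" for m
    using row_block_rim_nth that by (simp add: B_def)
  have distB: "distinct B"
    by (simp add: B_def distinct_block_rim)
  have add_p: "[S j cs' = 0] (mod p) \<or> [S j cs' = k + b - 1] (mod p) \<Longrightarrow>
      [p + S j cs' = 0] (mod p) \<or> [p + S j cs' = k + b - 1] (mod p)" for j cs'
    by (simp add: cong_def)
  have "[S i bs = 0] (mod p) \<or> [S i bs = k + b - 1] (mod p)"
  \<comment> \<open>As \<open>a < p\<close>, a full segment inside the block reaches its last row,
    so the next segment starts at the next block.\<close>
  proof (cases "p \<le> length B")
    case True
    have "take p B \<noteq> []"
      using True la by auto
    hence last: "fst (last (take p B)) = i + (a - 1)"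
      using True la last_row[of "p - 1"] by (simp add: last_conv_nth)
    have "card (set (concat (p_segments p (take p B @ drop p B @ rim_rows (i + a) (expand cs)))))
        = length (take p B) + S (i + a) cs"
      unfolding S_def
    proof (rule card_p_segments)
      show "fst n \<le> fst (last (take p B))" if "n \<in> set (take p B @ drop p B)" for n
        using that rowsB unfolding last by simp
      show "fst (last (take p B)) < fst n" if "n \<in> set (rim_rows (i + a) (expand cs))" for n
        using row_rim_rows[OF that] la unfolding last by simp
    qed (use True distB \<open>take p B \<noteq> []\<close> in auto)
    also have "take p B @ drop p B @ rim_rows (i + a) (expand cs) = rim_rows i (expand bs)"
      unfolding rim by (simp add: append_assoc[symmetric] del: append_assoc)
    finally have "S i bs = length (take p B) + S (i + a) cs"
      by (simp only: S_def[of i])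
    moreover have "[S (i + a) cs = 0] (mod p) \<or> [S (i + a) cs = k + b - 1] (mod p)"
      using 1(2,4) bs by (intro IH) (auto dest: JS_blocks_tl)
    ultimately show ?thesis
      using True add_p by simp
  next
    case False
    show ?thesis
    proof (cases cs)
      case Nil
      \<comment> \<open>A last block shorter than \<open>p\<close> is one incomplete segment of size
        \<open>k + b - 1\<close>, the source of the second alternative.\<close>
      have "B \<noteq> []" using lenB h by auto
      moreover have "fst (last B) = i + (a - 1)"
        using lenB h last_row[of "length B - 1"] by (simp add: last_conv_nth[OF \<open>B \<noteq> []\<close>])
      ultimately have "S i bs = length B"
        unfolding S_def rim Nil using card_p_segments[of p B "[]" "[]"] False distB rowsB by simp
      moreover have "length B = k + b - 1"
        using lenB la 1(4) bs Nil by (simp add: h_def)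
      ultimately show ?thesis by simp
    next
      case (Cons x ds)
      obtain l' a' where x: "x = (l', a')" by fastforce
      have la': "0 < l'" "0 < a'" "a' < p"
        using 1(2) bs Cons x JS_blocks_tl[of p "(l, a)" cs] JS_blocks_pos[of p l' a' ds] by auto
      have "h = l'"
        by (simp add: h_def Cons x part_replicate_append la')
      \<comment> \<open>The JS congruence makes \<open>length B + a'\<close> a multiple of
        \<open>p\<close>. It is positive and below \<open>2 * p\<close>, hence equal to
        \<open>p\<close>: the segment ends at the \<open>a'\<close>-th rim node of the next block,
        the first in that block's last row. Both blocks are thus used up.\<close>
      hence "int (length B + a') = int l - int l' + int a + int a'"
        using lenB la la' h by (simp add: of_nat_diff)
      moreover have "[int l - int l' + int a + int a' = 0] (mod int p)"
        using 1(2) bs Cons x by simp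
      ultimately have "p dvd length B + a'"
        by (metis cong_0_iff int_dvd_int_iff)
      then obtain q where q: "length B + a' = p * q" ..
      moreover have "0 < length B + a'" "length B + a' < p * 2"
        using la' False by auto
      ultimately have "0 < q" "q < 2"
        by auto
      with q have p: "length B + a' = p"
        by (simp add: less_2_cases_iff)
      define h' where "h' = part (expand ds) 0"
      define B' where "B' = block_rim (i + a) a' l' h'"
      have h': "h' < l'"
        using part_expand_less JS_blocks_tl 1(2) bs Cons x by (metis h'_def)
      have rim': "rim_rows i (expand bs) = B @ B' @ rim_rows (i + a + a') (expand ds)"
        unfolding rim by (simp add: Cons x B'_def h'_def rim_rows_block la')
      have lenB': "a' \<le> length B'"
        using h' la' by (simp add: B'_def length_block_rim)
      have rowsB': "i + a \<le> fst n" "fst n \<le> i + a + (a' - 1)" if "n \<in> set B'" for n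
        using row_block_rim[OF la'(2), of n "i + a" l' h'] that by (auto simp: B'_def)
      have "take a' B' \<noteq> []" using lenB' la' by auto
      hence "last (B @ take a' B') = B' ! (a' - 1)"
        using lenB' la' by (simp add: last_conv_nth[of "take a' B'"])
      hence last: "fst (last (B @ take a' B')) = i + a + (a' - 1)"
        using lenB' la' row_block_rim_nth[of a' "a' - 1" "i + a" l' h'] by (simp add: B'_def)
      have "n \<notin> set B'" if "n \<in> set B" for n
        using rowsB[OF that] rowsB'(1)[of n] la by (cases "n \<in> set B'") simp_all
      moreover have "distinct B'"
        by (simp add: B'_def distinct_block_rim)
      ultimately have dist: "distinct (B @ take a' B')"
        using distB by (auto dest: in_set_takeD)
      have "card (set (concat (p_segments p
            ((B @ take a' B') @ drop a' B' @ rim_rows (i + a + a') (expand ds)))))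
          = length (B @ take a' B') + S (i + a + a') ds"
        unfolding S_def
      proof (rule card_p_segments[OF _ _ dist])
        show "fst n \<le> fst (last (B @ take a' B'))" if "n \<in> set ((B @ take a' B') @ drop a' B')" for n
        proof -
          have "n \<in> set B \<or> n \<in> set B'"
            using that by (auto dest: in_set_takeD in_set_dropD)
          then show ?thesis
            using rowsB[of n] rowsB'(2)[of n] unfolding last by auto
        qed
        show "fst (last (B @ take a' B')) < fst n" if "n \<in> set (rim_rows (i + a + a') (expand ds))" for n
          using row_rim_rows[OF that] la' unfolding last by simp
      qed (use p lenB' \<open>take a' B' \<noteq> []\<close> in auto)
      also have "(B @ take a' B') @ drop a' B' @ rim_rows (i + a + a') (expand ds)
          = B @ (take a' B' @ drop a' B') @ rim_rows (i + a + a') (expand ds)"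
        by (simp only: append_assoc)
      also have "\<dots> = rim_rows i (expand bs)"
        unfolding rim' append_take_drop_id ..
      finally have "S i bs = p + S (i + a + a') ds"
        using p lenB' by (simp add: S_def[of i])
      moreover have "[S (i + a + a') ds = 0] (mod p) \<or> [S (i + a + a') ds = k + b - 1] (mod p)"
        using 1(2,4) bs Cons x by (intro IH) (auto dest: JS_blocks_tl)
      ultimately show ?thesis
        using add_p by simp
    qed
  qed
  then show ?case by (simp add: S_def)
qed

lemma card_p_rim_blocks:
  assumes "JS_blocks p bs" "bs \<noteq> []" "last bs = (k, b)" "\<not> p dvd card (p_rim p (expand bs))"
  shows "[card (p_rim p (expand bs)) = k + b - 1] (mod p)"
  using card_p_segments_blocks[OF assms(1-3), of 0] assms(4)
  by (auto simp: p_rim_def rim_eq_rim_rows cong_0_iff)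

section \<open>Square cores\<close>

text \<open>Any \<open>p\<close> consecutive integers meet each residue class once, wherever the run
  starts.\<close>

lemma sum_full_rounds:
  assumes "p > 0"
  shows "(\<Sum>j<q * p. of_bool [e - int j = c] (mod int p)) = q"
proof (induction q arbitrary: e)
  case (Suc q)
  have "(\<Sum>j<p. of_bool [e - int j = c] (mod int p))
      = card {j \<in> {..<p}. [e - int j = c] (mod int p)}"
    by (simp add: Int_def)
  also have "\<dots> = card ((\<lambda>j. e - int j) ` {j \<in> {..<p}. [e - int j = c] (mod int p)})"
    by (rule card_image[symmetric]) (simp add: inj_on_def)
  also have "(\<lambda>j. e - int j) ` {j \<in> {..<p}. [e - int j = c] (mod int p)}
      = {d \<in> {e - int p<..e}. [d = c] (mod int p)}"
  proof (intro equalityI subsetI)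
    fix d assume "d \<in> {d \<in> {e - int p<..e}. [d = c] (mod int p)}"
    then show "d \<in> (\<lambda>j. e - int j) ` {j \<in> {..<p}. [e - int j = c] (mod int p)}"
      by (intro image_eqI[of _ _ "nat (e - d)"]) auto
  qed auto
  also have "card \<dots> = 1"
    by (rule card_cong_interval[OF assms])
  finally have "(\<Sum>j<p. of_bool [e - int j = c] (mod int p)) = (1 :: nat)" .
  moreover have "(\<Sum>j<q * p. of_bool [e - int (p + j) = c] (mod int p)) = q"
    using Suc[of "e - int p"] by (simp add: algebra_simps)
  ultimately show ?case
    by (simp add: sum_lessThan_add del: of_nat_add)
qed simp

lemma is_partition_square: "is_partition (replicate l l)"
  by (auto simp: is_partition_def sorted_wrt_iff_nth_less)

lemma part_square: "part (replicate l l) i = (if i < l then l else 0)"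
  by (simp add: part_def)

lemma bead_count_square:
  "bead_count p (l + n) (replicate l l) c
    = (\<Sum>i<l. of_bool [int l - int i = c] (mod int p)) + (\<Sum>i<n. of_bool [- int l - int i = c] (mod int p))"
  unfolding bead_count_def sum_lessThan_add
  by (intro arg_cong2[where f = "(+)"] sum.cong refl) (simp_all add: bead_def part_square minus_add_distrib)

text \<open>Beads are at most \<open>l\<close>, so shifting by \<open>- p\<close> leads to
  \<open>- l\<close> or below, where the zero rows fill every position down to \<open>1 - R\<close>.
  Thus a square with \<open>2 * l \<le> p\<close> is a core.\<close>

lemma beads_square_closed:
  assumes "2 * l \<le> p" "b \<in> bead (replicate l l) ` {..<R}" "1 - int R \<le> b - int p"
  shows "b - int p \<in> bead (replicate l l) ` {..<R}"
proof -
  define i where "i = nat (int p - b)"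
  have "b \<le> int l"
    using assms(2) by (auto simp: bead_def part_square)
  hence "int i = int p - b" "l \<le> i" "i < R"
    using assms(1,3) by (auto simp: i_def)
  then show ?thesis
    by (intro image_eqI[of _ _ i]) (auto simp: bead_def part_square)
qed

lemma p_core_square:
  assumes p: "p > 0" and lam: "is_partition lam" and l: "2 * l \<le> p" "l \<le> length lam"
    and count: "\<And>c. bead_count p (length lam) lam c
      = (\<Sum>i<length lam. of_bool [int (length lam) - int i = c] (mod int p))"
    and len: "[int (length lam) = int l] (mod int p) \<or> [int (length lam) = - int l] (mod int p)"
  shows "p_core p lam = replicate l l"
proof (rule p_core_eqI[OF p lam is_partition_square, where R = "length lam"])
  define n where "n = length lam - l"
  have R: "length lam = l + n" using l by (simp add: n_def)
  have "bead_count p (l + n) lam c = bead_count p (l + n) (replicate l l) c" for c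
    using len
  proof
    assume cong: "[int (length lam) = int l] (mod int p)"
    \<comment> \<open>The \<open>n\<close> zero rows of the square form full rounds, and the
      remaining \<open>l\<close> residues agree.\<close>
    hence "p dvd n"
      unfolding R by (simp add: cong_iff_dvd_diff)
    then obtain q where q: "n = q * p"
      by (metis dvd_div_mult_self)
    have "[int (l + n) - int i = c] (mod int p) \<longleftrightarrow> [int l - int i = c] (mod int p)" for i
      using cong cong_diff[OF cong cong_refl[of "int i"]] unfolding R by (meson cong_sym cong_trans)
    then have "(\<Sum>i<l + n. of_bool [int (l + n) - int i = c] (mod int p))
        = (\<Sum>i<l. of_bool [int l - int i = c] (mod int p))
          + (\<Sum>i<n. of_bool [0 - int i = c] (mod int p) :: nat)"
      by (simp add: sum_lessThan_add del: of_nat_add) (simp add: algebra_simps)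
    then show ?thesis
      using count[of c] unfolding R bead_count_square q sum_full_rounds[OF p] by simp
  next
    assume cong: "[int (length lam) = - int l] (mod int p)"
    \<comment> \<open>The run from \<open>R\<close> down first passes the residues of the
      \<open>n\<close> zero rows; its last \<open>l\<close> values are exactly
      \<open>l, ..., 1\<close>, the beads of the square's rows.\<close>
    have "[int (n + l) - int i = c] (mod int p) \<longleftrightarrow> [- int l - int i = c] (mod int p)" for i
      using cong_diff[OF cong cong_refl[of "int i"]] unfolding R
      by (metis add.commute cong_sym cong_trans)
    then have "(\<Sum>i<n + l. of_bool [int (n + l) - int i = c] (mod int p))
        = (\<Sum>i<n. of_bool [- int l - int i = c] (mod int p))
          + (\<Sum>i<l. of_bool [int (n + l) - int (n + i) = c] (mod int p) :: nat)"
      by (simp only: sum_lessThan_add)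
    then show ?thesis
      using count[of c] unfolding R bead_count_square by (simp add: add.commute)
  qed
  then show "bead_count p (length lam) lam c = bead_count p (length lam) (replicate l l) c" for c
    by (simp add: R)
  show "b - int p \<in> bead (replicate l l) ` {..<length lam}"
    if "b \<in> bead (replicate l l) ` {..<length lam}" "1 - int (length lam) \<le> b - int p" for b
    using beads_square_closed l(1) that by blast
qed (use l in auto)

lemma p_core_empty:
  assumes p: "p > 0" and lam: "is_partition lam" and dvd: "p dvd length lam"
    and count: "\<And>c. bead_count p (length lam) lam c
      = (\<Sum>i<length lam. of_bool [e - int i = c] (mod int p))"
  shows "p_core p lam = []"
proof (rule p_core_eqI[OF p lam, where R = "length lam"])
  obtain q where q: "length lam = q * p"
    using dvd by (metis dvd_div_mult_self)
  show "bead_count p (length lam) lam c = bead_count p (length lam) [] c" for c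
    \<comment> \<open>The empty partition is the square with \<open>l = 0\<close>, and both counts
      are full rounds.\<close>
    using bead_count_square[of p 0 "length lam" c] sum_full_rounds[OF p, of 0 c q]
      sum_full_rounds[OF p, of e c q] count[of c] by (simp add: q)
  show "b - int p \<in> bead [] ` {..<length lam}"
    if "b \<in> bead [] ` {..<length lam}" "1 - int (length lam) \<le> b - int p" for b
    using beads_square_closed[of 0 p b "length lam"] that by simp
qed (auto simp: is_partition_def)

section \<open>The first column of the Mullineux symbol\<close>

lemma mullineux_symbol_first:
  assumes "mullineux_symbol p lam \<noteq> []"
  shows "lam \<noteq> []" and "hd (mullineux_symbol p lam) = (card (p_rim p lam), length lam)"
proof -
  define m where "m = (LEAST m. (remove_p_rim p ^^ m) lam = [])"
  have "m > 0"
    using assms by (auto simp: mullineux_symbol_def m_def)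
  hence "(remove_p_rim p ^^ 0) lam \<noteq> []"
    unfolding m_def by (rule not_less_Least)
  then show "lam \<noteq> []" by simp
  show "hd (mullineux_symbol p lam) = (card (p_rim p lam), length lam)"
    using \<open>m > 0\<close> unfolding mullineux_symbol_def m_def[symmetric] by (simp add: hd_map Let_def)
qed

lemma mullineux_fixed_first:
  assumes "mullineux_fixed p lam" "mullineux_symbol p lam \<noteq> []"
  shows "2 * int (length lam)
    = int (card (p_rim p lam)) + (if p dvd card (p_rim p lam) then 0 else 1)"
  using assms mullineux_symbol_first(2)[OF assms(2)]
  by (cases "mullineux_symbol p lam") (auto simp: mullineux_fixed_def mullineux_image_def)

section \<open>From the residue symbol to the core\<close>

theorem theorem4p2:
  fixes p :: nat and lam :: "nat list" and x y :: int
  assumes "p > 2"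
    and "JS_partition p lam"
    and "mullineux_fixed p lam"
    and "residue_symbol p lam \<noteq> []"
    and "last (residue_symbol p lam) = (x, y)"
  shows "(\<forall>l::nat. 1 \<le> l \<and> 2 * l \<le> p - 1 \<and>
            (\<exists>c \<in> {(int l - 1, 1 - int l), (- int l - 1, int l + 1),
                    (int l, 1 + int l), (- int l, 1 - int l)}. cong_pair p (x, y) c)
            \<longrightarrow> p_core p lam = replicate l l) \<and>
         ((\<exists>c \<in> {(- 1, 1), (0, 1)}. cong_pair p (x, y) c) \<longrightarrow> p_core p lam = [])"
proof -
  define R where "R = length lam"
  define A where "A = card (p_rim p lam)"
  have p: "p > 0" using assms(1) by simp
  have lam: "is_partition lam"
    using assms(2) by (simp add: JS_partition_def p_regular_def)
  have sym: "mullineux_symbol p lam \<noteq> []"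
    using assms(4) by (simp add: residue_symbol_def)
  \<comment> \<open>The residue symbol reverses the columns, so its last column comes from
    \<open>lam\<close> itself.\<close>
  have "y = (1 - int R) mod int p"
    using assms(5) sym mullineux_symbol_first(2)[OF sym]
    by (simp add: residue_symbol_def last_map last_rev R_def)
  hence y: "[y = z] (mod int p) \<longleftrightarrow> [int R = 1 - z] (mod int p)" for z
    by (simp add: cong_def mod_eq_dvd_iff) (simp add: dvd_diff_commute algebra_simps)
  obtain bs where bs: "JS_blocks p bs" "expand bs = lam"
    using ex_JS_blocks assms(2) by blast
  have "bs \<noteq> []"
    using bs mullineux_symbol_first(1)[OF sym] by auto
  obtain k b where kb: "last bs = (k, b)" by fastforce
  have count: "bead_count p R lam c
      = (\<Sum>i<R. of_bool [int k + int b - int R - int i = c] (mod int p))" for c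
    using bead_count_blocks[OF bs(1) \<open>bs \<noteq> []\<close> kb] bs(2) by (simp add: R_def)
  have A: "2 * int R = int A + (if p dvd A then 0 else 1)"
    using mullineux_fixed_first[OF assms(3) sym] by (simp add: R_def A_def)
  have square: "p_core p lam = replicate l l"
    if l: "1 \<le> l" "2 * l \<le> p - 1"
      and cong: "[int R = int l] (mod int p) \<or> [int R = - int l] (mod int p)" for l
  proof (rule p_core_square[OF p lam])
    \<comment> \<open>Otherwise \<open>p\<close> divides \<open>2 * R\<close>, hence
      \<open>2 * l\<close>, although \<open>0 < 2 * l < p\<close>.\<close>
    have "\<not> p dvd A"
    proof
      assume "p dvd A"
      hence "int p dvd 2 * int R" using A by simp
      moreover have "int p dvd 2 * int R - 2 * int l \<or> int p dvd 2 * int R + 2 * int l"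
        using cong by (metis cong_iff_dvd_diff dvd_mult right_diff_distrib' diff_minus_eq_add
          distrib_left)
      ultimately have "int p dvd 2 * int l"
        by (metis dvd_add_right_iff dvd_diff_right_iff)
      hence "p dvd 2 * l"
        by (metis int_dvd_int_iff of_nat_mult of_nat_numeral)
      with l p show False by (auto dest: dvd_imp_le)
    qed
    hence "[A = k + b - 1] (mod p)"
      using card_p_rim_blocks[OF bs(1) \<open>bs \<noteq> []\<close> kb] bs(2) by (simp add: A_def)
    hence "[int A = int (k + b - 1)] (mod int p)"
      by (simp add: cong_int_iff)
    \<comment> \<open>Positivity keeps the subtraction in \<open>k + b - 1\<close> from
      truncating.\<close>
    moreover have "0 < b"
    proof -
      have "(k, b) \<in> set bs" using kb \<open>bs \<noteq> []\<close> by (metis last_in_set)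
      then show ?thesis
        using bs(1) by (induction bs) (auto dest: JS_blocks_pos JS_blocks_tl)
    qed
    hence "int (k + b - 1) = int k + int b - 1" by auto
    moreover have "int A = 2 * int R - 1"
      using A \<open>\<not> p dvd A\<close> by simp
    ultimately have "[2 * int R - 1 = int k + int b - 1] (mod int p)" by simp
    hence "int p dvd (2 * int R - 1) - (int k + int b - 1)"
      by (simp add: cong_iff_dvd_diff)
    \<comment> \<open>Since \<open>k + b\<close> is congruent to \<open>2 * R\<close>, the run of
      bead residues starts at \<open>R\<close>.\<close>
    hence "[int R - int i = int k + int b - int R - int i] (mod int p)" for i
      by (simp add: cong_iff_dvd_diff algebra_simps)
    hence "[int k + int b - int R - int i = c] (mod int p) \<longleftrightarrow> [int R - int i = c] (mod int p)" for i c
      by (meson cong_sym cong_trans)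
    then show "bead_count p (length lam) lam c
        = (\<Sum>i<length lam. of_bool [int (length lam) - int i = c] (mod int p))" for c
      using count unfolding R_def by simp
    show "l \<le> length lam"
    proof (rule ccontr)
      assume "\<not> l \<le> length lam"
      hence "R < l" by (simp add: R_def)
      \<comment> \<open>Both \<open>l - R\<close> and \<open>l + R\<close> would be positive and
        smaller than \<open>p\<close>.\<close>
      have "int p dvd int l - int R \<or> int p dvd int l + int R"
        using cong by (auto simp: cong_iff_dvd_diff dvd_diff_commute add.commute)
      hence "int p \<le> int l - int R \<or> int p \<le> int l + int R"
        using \<open>R < l\<close> by (auto dest: zdvd_imp_le)
      with \<open>R < l\<close> l show False by auto
    qed
    show "[int (length lam) = int l] (mod int p) \<or> [int (length lam) = - int l] (mod int p)"
      using cong by (simp add: R_def)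
  qed (use l in simp)
  have empty: "p_core p lam = []" if "[int R = 0] (mod int p)"
  proof (rule p_core_empty[OF p lam])
    show "p dvd length lam"
      using that by (simp add: cong_0_iff R_def)
  qed (use count R_def in simp)
  show ?thesis
    using square empty by (auto simp: cong_pair_def y)
qed

end
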